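(* Let $(\lambda_k)_{k\ge1}$ be pairwise distinct positive reals and, for $0<\nu\le1$ and $t>0$, let $$p_1^\nu(t)=E_{\nu,1}(-\lambda_1t^\nu),\qquad p_k^\nu(t)=\prod_{j=1}^{k-1}\lambda_j\ \sum_{m=1}^{k}\frac{E_{\nu,1}(-\lambda_mt^\nu)}{\prod_{l=1,\,l\neq m}^{k}(\lambda_l-\lambda_m)}\quad(k>1)$$ be the state probabilities of the fractional birth process with rates $\lambda_k$ and one initial progenitor. Then $p_k^\nu(t)\ge0$ for all $k\ge1$, $t>0$, $0<\nu\le1$. Furthermore, for every $0<\nu\le1$, the fractional birth process is non-exploding, i.e. $\sum_{k\ge1}p_k^\nu(t)=1$ for all $t>0$, if and only if $\sum_{k\ge1}\frac{1}{\lambda_k}=\infty$.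
   Context: $E_{\nu,1}(x)=\sum_{h=0}^\infty\frac{x^h}{\Gamma(\nu h+1)}$ is the Mittag-Leffler function. The functions $p_k^\nu$ solve $\frac{\mathrm{d}^\nu p_k}{\mathrm{d}t^\nu}=-\lambda_kp_k+\lambda_{k-1}p_{k-1}$, $k\ge1$ (with $\lambda_0p_0\equiv0$), $p_1(0)=1$, $p_k(0)=0$ for $k\ge2$, where $\frac{\mathrm{d}^\nu}{\mathrm{d}t^\nu}$ is the Dzherbashyan--Caputo derivative $\frac{\mathrm{d}^\nu p}{\mathrm{d}t^\nu}(t)=\frac1{\Gamma(1-\nu)}\int_0^t\frac{p'(s)}{(t-s)^\nu}\mathrm{d}s$ for $0<\nu<1$ and the ordinary derivative for $\nu=1$. *)

theory Defs
  imports "HOL-Analysis.Analysis"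
begin

definition mittag_leffler :: "real \<Rightarrow> real \<Rightarrow> real \<Rightarrow> real" where
  "mittag_leffler \<nu> \<beta> x = (\<Sum>h. x ^ h / Gamma (\<nu> * real h + \<beta>))"

text \<open>
  Rates are a sequence indexed from 1; the value \<open>rate 0\<close> is never used, and states
  are likewise only meaningful for \<open>k \<ge> 1\<close>.
\<close>

definition fbp_prob :: "(nat \<Rightarrow> real) \<Rightarrow> real \<Rightarrow> nat \<Rightarrow> real \<Rightarrow> real" where
  "fbp_prob rate \<nu> k t =
     (if k = 1 then mittag_leffler \<nu> 1 (- rate 1 * t powr \<nu>)
      else (\<Prod>j=1..k-1. rate j) *
           (\<Sum>m=1..k. mittag_leffler \<nu> 1 (- rate m * t powr \<nu>) /
                      (\<Prod>l\<in>{1..k} - {m}. rate l - rate m)))"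

definition non_exploding :: "(nat \<Rightarrow> real) \<Rightarrow> real \<Rightarrow> bool" where
  "non_exploding rate \<nu> \<longleftrightarrow> (\<forall>t>0. (\<lambda>k. fbp_prob rate \<nu> (Suc k) t) sums 1)"

end

theory Submission
  imports Defs
begin

text \<open>
  The process is discretised on the time grid of mesh $t/N$, and everything about it is read off
  from generating functions, with $z$ marking the time step. For real $a$ let
  $R_a(z) = (1-z)^{-a}$. A grid version of the Caputo derivative is multiplication by
  $R_{-\<nu>}$ (up to a power of the mesh), and of the fractional integral multiplication by
  $R_\<nu>$. With $\<mu>_k = \<lambda>_k (t/N)^\<nu>$ the discrete state probabilities are
    \[ P_k = R_{1-\<nu>}\, V_k \prod_{j<k} \<mu>_j V_j, \qquad V_j = \frac{1}{R_{-\<nu>} + \<mu>_j} . \]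
  
  Nonnegativity: for $0 < \<nu> \<le> 1$ all coefficients of $R_{-\<nu>}$ except the constant one are
  nonpositive, hence the resolvents $V_j$, and with them the $P_k$, have nonnegative coefficients
  (\<open>state_fps_nonneg\<close>). Partial fractions write $P_k$ through the single functions
  $R_{1-\<nu>} V_m$ exactly as the claimed formula writes $p_k^\<nu>$ through Mittag-Leffler functions,
  and the $N$th coefficient of $R_{1-\<nu>} V_m$ tends to $E_{\<nu>,1}(-\<lambda>_m t^\<nu>)$
  (\<open>mittag_leffler_limit\<close>). So $p_k^\<nu>(t)$ is a limit of nonnegative numbers. This replaces
  the complete monotonicity of $x \<mapsto> E_{\<nu>,1}(-x)$.
  
  Explosion: let $Q_n = \prod_{j \<le> n} \<mu>_j V_j$, the law of the step at which the population
  passes $n$. Then $P_1 + \dots + P_n = R_1 (1 - Q_n)$, and since $R_\<nu> R_{1-\<nu>} = R_1$,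
    \[ R_\<nu> (P_1 + \dots + P_n) = \sum_{k \<le> n} \frac{1}{\<mu>_k} R_1 Q_k . \]
  That is, fractionally integrating the probability $S_n$ of having at most $n$ individuals gives
  the sum of $(1 - S_k)/\<mu>_k$ over $k \<le> n$ (\<open>prob_le_convolution\<close>). As $S_n$ decreases
  in time, increases with $n$ and lies between $0$ and $1$, this identity gives in the limit
    \[ (1 - S_n(t)) \sum_{k \<le> n} \frac{1}{\<lambda>_k} \<le> \frac{t^\<nu>}{\<Gamma>(\<nu>+1)}
       \qquad\mbox{and}\qquad
       S_n(t) \frac{t^\<nu>}{\<Gamma>(\<nu>+1)} \<le> \sum_{k \<le> n} \frac{1}{\<lambda>_k} \]
  (\<open>fbp_prob_sum_bounds\<close>). If the series of $1/\<lambda>_k$ diverges, the first bound forces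
  $S_n(t) \to 1$; if it converges, the second keeps $S_n(t) \<le> 1/2$ for a suitably large $t$.
\<close>

section \<open>Coefficients of negative powers of $1 - z$\<close>

definition neg_binomial_fps :: "real \<Rightarrow> real fps" where
  "neg_binomial_fps a = Abs_fps (\<lambda>n. pochhammer a n / fact n)"

lemma neg_binomial_fps_nth: "fps_nth (neg_binomial_fps a) n = pochhammer a n / fact n"
  by (simp add: neg_binomial_fps_def)

lemma neg_binomial_fps_add: "neg_binomial_fps (a + b) = neg_binomial_fps a * neg_binomial_fps b"
proof (rule fps_ext)
  fix n
  have "pochhammer (a + b) n / fact n =
      (\<Sum>k\<le>n. real (n choose k) * pochhammer a k * pochhammer b (n - k) / fact n)"
    by (simp add: pochhammer_binomial_sum sum_divide_distrib)
  also have "\<dots> = (\<Sum>k\<le>n. (pochhammer a k / fact k) * (pochhammer b (n - k) / fact (n - k)))"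
    by (intro sum.cong refl) (simp add: binomial_fact field_simps)
  finally show "fps_nth (neg_binomial_fps (a + b)) n =
      fps_nth (neg_binomial_fps a * neg_binomial_fps b) n"
    by (simp add: neg_binomial_fps_nth fps_mult_nth atLeast0AtMost)
qed

lemma neg_binomial_fps_1_nth: "fps_nth (neg_binomial_fps 1) n = 1"
  by (simp add: neg_binomial_fps_nth pochhammer_fact [symmetric])

text \<open>
  Multiplication by $1/(1-z)$ takes partial sums, so it turns laws into distribution functions.
\<close>

lemma neg_binomial_fps_1_mult_nth:
  "fps_nth (neg_binomial_fps 1 * F) n = (\<Sum>i\<le>n. fps_nth F i)"
  by (subst mult.commute) (simp add: fps_mult_nth neg_binomial_fps_1_nth atLeast0AtMost)

lemma neg_binomial_fps_cancel:
  "neg_binomial_fps 1 * neg_binomial_fps (- \<nu>) = neg_binomial_fps (1 - \<nu>)"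
  "neg_binomial_fps \<nu> * neg_binomial_fps (1 - \<nu>) = neg_binomial_fps 1"
  by (simp_all add: neg_binomial_fps_add [symmetric])

lemma neg_binomial_fps_nonneg: "a \<ge> 0 \<Longrightarrow> fps_nth (neg_binomial_fps a) n \<ge> 0"
  by (auto simp: neg_binomial_fps_nth pochhammer_prod intro!: divide_nonneg_nonneg prod_nonneg)

lemma neg_binomial_fps_nonpos:
  assumes "0 \<le> \<nu>" "\<nu> \<le> 1" "n > 0"
  shows "fps_nth (neg_binomial_fps (- \<nu>)) n \<le> 0"
proof -
  obtain m where n: "n = Suc m" using assms(3) by (cases n) auto
  have "pochhammer (1 - \<nu>) m \<ge> 0"
    using assms by (auto simp: pochhammer_prod intro!: prod_nonneg)
  with assms have "(- \<nu>) * pochhammer (- \<nu> + 1) m \<le> 0"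
    by (intro mult_nonpos_nonneg) auto
  then show ?thesis
    by (simp add: n neg_binomial_fps_nth pochhammer_rec divide_nonpos_pos del: fact_Suc)
qed

lemma neg_binomial_fps_mono:
  assumes "a \<ge> 0" "M \<le> N"
  shows "fps_nth (neg_binomial_fps (a + 1)) M \<le> fps_nth (neg_binomial_fps (a + 1)) N"
proof -
  have "(\<Sum>i\<le>M. fps_nth (neg_binomial_fps a) i) \<le> (\<Sum>i\<le>N. fps_nth (neg_binomial_fps a) i)"
    using assms by (intro sum_mono2) (auto simp: neg_binomial_fps_nonneg)
  moreover have "neg_binomial_fps (a + 1) = neg_binomial_fps 1 * neg_binomial_fps a"
    by (simp add: neg_binomial_fps_add mult.commute)
  ultimately show ?thesis
    by (simp add: neg_binomial_fps_1_mult_nth)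
qed

text \<open>
  Normalising the constant coefficient to $c$, such a series is $c - G$ with $G$ nonnegative, and the
  geometric series $\sum_k G^k / c^{k+1}$ is nonnegative. The induction reads this off from
  $F \cdot F^{-1} = 1$ without expanding the geometric series.
\<close>

lemma fps_inverse_nonneg:
  fixes F :: "real fps"
  assumes "fps_nth F 0 > 0" and neg: "\<And>n. n > 0 \<Longrightarrow> fps_nth F n \<le> 0"
  shows "fps_nth (inverse F) n \<ge> 0"
proof (induction n rule: less_induct)
  case (less n)
  show ?case
  proof (cases "n = 0")
    case True
    then show ?thesis using assms(1) by simp
  next
    case False
    have "0 = fps_nth (F * inverse F) n"
      using False assms(1) by (subst inverse_mult_eq_1') auto
    also have "\<dots> = fps_nth F 0 * fps_nth (inverse F) n
        + (\<Sum>i=1..n. fps_nth F i * fps_nth (inverse F) (n - i))"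
      by (simp add: fps_mult_nth sum.atLeast_Suc_atMost)
    finally have "fps_nth F 0 * fps_nth (inverse F) n
        = - (\<Sum>i=1..n. fps_nth F i * fps_nth (inverse F) (n - i))"
      by simp
    also have "\<dots> \<ge> 0"
      using False by (auto intro!: sum_nonpos mult_nonpos_nonneg neg less)
    finally show ?thesis
      using assms(1) by (simp add: zero_le_mult_iff)
  qed
qed

lemma fps_mult_nonneg:
  fixes F G :: "real fps"
  assumes "\<And>n. fps_nth F n \<ge> 0" "\<And>n. fps_nth G n \<ge> 0"
  shows "fps_nth (F * G) n \<ge> 0"
  by (auto simp: fps_mult_nth intro!: sum_nonneg mult_nonneg_nonneg assms)

section \<open>The discrete fractional birth process\<close>

text \<open>
  The generating function of the discrete equation $D^\<nu> u = -y u$ started from $1$ is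
  $R_{1-\<nu>}$ times this resolvent of $D^\<nu>$.
\<close>

definition resolvent :: "real \<Rightarrow> real \<Rightarrow> real fps" where
  "resolvent \<nu> y = inverse (neg_binomial_fps (- \<nu>) + fps_const y)"

lemma resolvent_mult:
  assumes "y \<ge> 0"
  shows "resolvent \<nu> y * (neg_binomial_fps (- \<nu>) + fps_const y) = 1"
  unfolding resolvent_def using assms
  by (intro inverse_mult_eq_1) (simp add: neg_binomial_fps_nth)

lemma resolvent_nonneg:
  assumes "0 \<le> \<nu>" "\<nu> \<le> 1" "y \<ge> 0"
  shows "fps_nth (resolvent \<nu> y) n \<ge> 0"
  unfolding resolvent_def using assms
  by (intro fps_inverse_nonneg) (auto simp: neg_binomial_fps_nonpos, simp add: neg_binomial_fps_nth)

text \<open>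
  A product of laws, as for a sum of independent waiting times: the factor of index \<open>j\<close> has
  total mass $1$ when $\<nu> > 0$, and in the limit is the waiting time in state \<open>j\<close>.
\<close>

definition birth_time_fps :: "real \<Rightarrow> (nat \<Rightarrow> real) \<Rightarrow> nat \<Rightarrow> real fps" where
  "birth_time_fps \<nu> \<mu> n = (\<Prod>j=1..n. fps_const (\<mu> j) * resolvent \<nu> (\<mu> j))"

definition state_fps :: "real \<Rightarrow> (nat \<Rightarrow> real) \<Rightarrow> nat \<Rightarrow> real fps" where
  "state_fps \<nu> \<mu> k = neg_binomial_fps (1 - \<nu>) * resolvent \<nu> (\<mu> k) * birth_time_fps \<nu> \<mu> (k - 1)"

definition prob_le :: "real \<Rightarrow> (nat \<Rightarrow> real) \<Rightarrow> nat \<Rightarrow> nat \<Rightarrow> real" where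
  "prob_le \<nu> \<mu> n m = (\<Sum>k=1..n. fps_nth (state_fps \<nu> \<mu> k) m)"

context
  fixes \<nu> :: real and \<mu> :: "nat \<Rightarrow> real"
  assumes \<nu>: "0 \<le> \<nu>" "\<nu> \<le> 1" and \<mu>: "\<And>k. k \<ge> 1 \<Longrightarrow> \<mu> k > 0"
begin

lemma birth_time_fps_step:
  assumes "k \<ge> 1"
  shows "birth_time_fps \<nu> \<mu> k = birth_time_fps \<nu> \<mu> (k - 1) * (fps_const (\<mu> k) * resolvent \<nu> (\<mu> k))"
  using assms by (cases k) (auto simp: birth_time_fps_def)

lemma birth_time_fps_nonneg: "fps_nth (birth_time_fps \<nu> \<mu> n) m \<ge> 0"
proof (induction n arbitrary: m)
  case 0
  then show ?case by (simp add: birth_time_fps_def)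
next
  case (Suc n)
  then show ?case
    using \<nu> \<mu>[of "Suc n"]
    by (subst birth_time_fps_step) (auto intro!: fps_mult_nonneg resolvent_nonneg mult_nonneg_nonneg)
qed

lemma state_fps_nonneg: "k \<ge> 1 \<Longrightarrow> fps_nth (state_fps \<nu> \<mu> k) m \<ge> 0"
  unfolding state_fps_def using \<nu> \<mu>[of k]
  by (intro fps_mult_nonneg neg_binomial_fps_nonneg resolvent_nonneg birth_time_fps_nonneg) auto

text \<open>
  Being in state \<open>k\<close> means that the birth of index $k-1$ has taken place and that of index
  \<open>k\<close> has not; algebraically this is $R_{-\<nu>} V_k = 1 - \<mu>_k V_k$.
\<close>

lemma state_fps_eq_diff:
  assumes "k \<ge> 1"
  shows "state_fps \<nu> \<mu> k =
    neg_binomial_fps 1 * (birth_time_fps \<nu> \<mu> (k - 1) - birth_time_fps \<nu> \<mu> k)"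
proof -
  let ?V = "resolvent \<nu> (\<mu> k)" and ?B = "neg_binomial_fps (- \<nu>)" and ?c = "fps_const (\<mu> k)"
  have "?V * ?B + ?V * ?c = 1"
    using resolvent_mult[of "\<mu> k" \<nu>] \<mu>[OF assms] by (simp add: distrib_left)
  then have "?V * ?B = 1 - ?c * ?V"
    by (simp add: algebra_simps)
  moreover have "state_fps \<nu> \<mu> k =
      neg_binomial_fps 1 * (birth_time_fps \<nu> \<mu> (k - 1) * (?V * ?B))"
    by (simp add: state_fps_def neg_binomial_fps_cancel(1)[symmetric] mult_ac)
  ultimately show ?thesis
    by (simp add: birth_time_fps_step[OF assms] right_diff_distrib)
qed

lemma sum_state_fps:
  "(\<Sum>k=1..n. state_fps \<nu> \<mu> k) = neg_binomial_fps 1 * (1 - birth_time_fps \<nu> \<mu> n)"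
proof (induction n)
  case 0
  then show ?case by (simp add: birth_time_fps_def)
next
  case (Suc n)
  then show ?case by (simp add: state_fps_eq_diff algebra_simps)
qed

text \<open>
  Only the factor $R_{1-\<nu>}$ of the state function depends on the fractional integral, which
  completes it to $R_1$; what remains is the law of the \<open>k\<close>th birth time divided by its rate.
\<close>

lemma fractional_integral_state_fps:
  assumes "k \<ge> 1"
  shows "neg_binomial_fps \<nu> * state_fps \<nu> \<mu> k =
    fps_const (1 / \<mu> k) * (neg_binomial_fps 1 * birth_time_fps \<nu> \<mu> k)"
proof -
  have c: "fps_const (1 / \<mu> k) * fps_const (\<mu> k) = 1"
    using \<mu>[OF assms] by simp
  have "neg_binomial_fps \<nu> * state_fps \<nu> \<mu> k =
      neg_binomial_fps 1 * (resolvent \<nu> (\<mu> k) * birth_time_fps \<nu> \<mu> (k - 1))"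
    by (simp add: state_fps_def neg_binomial_fps_cancel(2)[of \<nu>, symmetric] mult_ac)
  also have "\<dots> = (fps_const (1 / \<mu> k) * fps_const (\<mu> k)) *
      (neg_binomial_fps 1 * (resolvent \<nu> (\<mu> k) * birth_time_fps \<nu> \<mu> (k - 1)))"
    using c by simp
  finally show ?thesis
    by (simp only: birth_time_fps_step[OF assms] mult_ac)
qed

lemma prob_le_eq: "prob_le \<nu> \<mu> n m = 1 - (\<Sum>i\<le>m. fps_nth (birth_time_fps \<nu> \<mu> n) i)"
proof -
  have "prob_le \<nu> \<mu> n m = fps_nth (\<Sum>k=1..n. state_fps \<nu> \<mu> k) m"
    by (simp add: prob_le_def fps_sum_nth)
  also have "\<dots> = (\<Sum>i\<le>m. fps_nth (1 - birth_time_fps \<nu> \<mu> n) i)"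
    by (simp only: sum_state_fps neg_binomial_fps_1_mult_nth)
  also have "\<dots> = 1 - (\<Sum>i\<le>m. fps_nth (birth_time_fps \<nu> \<mu> n) i)"
    by (simp add: sum_subtractf)
  finally show ?thesis .
qed

lemma prob_le_le_1: "prob_le \<nu> \<mu> n m \<le> 1"
  by (auto simp: prob_le_eq intro!: sum_nonneg birth_time_fps_nonneg)

lemma prob_le_nonneg: "prob_le \<nu> \<mu> n m \<ge> 0"
  by (auto simp: prob_le_def intro!: sum_nonneg state_fps_nonneg)

lemma prob_le_mono: "k \<le> n \<Longrightarrow> prob_le \<nu> \<mu> k m \<le> prob_le \<nu> \<mu> n m"
  unfolding prob_le_def by (intro sum_mono2) (auto intro: state_fps_nonneg)

lemma prob_le_antimono: "i \<le> m \<Longrightarrow> prob_le \<nu> \<mu> n m \<le> prob_le \<nu> \<mu> n i"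
  unfolding prob_le_eq by (auto intro!: sum_mono2 birth_time_fps_nonneg)

text \<open>
  The identity behind both directions of the explosion criterion: it links the reciprocals of the
  rates to the probabilities without any estimate.
\<close>

lemma prob_le_convolution:
  "(\<Sum>i\<le>m. fps_nth (neg_binomial_fps \<nu>) (m - i) * prob_le \<nu> \<mu> n i) = (\<Sum>k=1..n. (1 - prob_le \<nu> \<mu> k m) / \<mu> k)"
proof -
  have "(\<Sum>i\<le>m. fps_nth (neg_binomial_fps \<nu>) (m - i) * prob_le \<nu> \<mu> n i)
      = (\<Sum>k=1..n. \<Sum>i\<le>m. fps_nth (neg_binomial_fps \<nu>) (m - i) * fps_nth (state_fps \<nu> \<mu> k) i)"
    unfolding prob_le_def sum_distrib_left by (rule sum.swap)
  also have "\<dots> = (\<Sum>k=1..n. fps_nth (neg_binomial_fps \<nu> * state_fps \<nu> \<mu> k) m)"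
    unfolding mult.commute [of "neg_binomial_fps \<nu>"] fps_mult_nth atLeast0AtMost
    by (intro sum.cong refl mult.commute)
  also have "\<dots> = (\<Sum>k=1..n. (1 - prob_le \<nu> \<mu> k m) / \<mu> k)"
    by (intro sum.cong refl)
      (simp add: fractional_integral_state_fps prob_le_eq fps_mult_left_const_nth neg_binomial_fps_1_mult_nth)
  finally show ?thesis .
qed

lemma sum_weights:
  "(\<Sum>i\<le>m. fps_nth (neg_binomial_fps \<nu>) (m - i)) = fps_nth (neg_binomial_fps (1 + \<nu>)) m"
  by (simp add: neg_binomial_fps_add fps_mult_nth neg_binomial_fps_1_nth atLeast0AtMost)

lemma weight_nonneg: "fps_nth (neg_binomial_fps \<nu>) i \<ge> 0"
  using \<nu>(1) by (rule neg_binomial_fps_nonneg)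

text \<open>
  Replace each $S_k$ by the larger $S_n$ on the right of the convolution identity and $S_n$ by $1$ on
  its left.
\<close>

lemma prob_le_lower: "(1 - prob_le \<nu> \<mu> n m) * (\<Sum>k=1..n. 1 / \<mu> k) \<le> fps_nth (neg_binomial_fps (1 + \<nu>)) m"
proof -
  have "(1 - prob_le \<nu> \<mu> n m) * (\<Sum>k=1..n. 1 / \<mu> k) = (\<Sum>k=1..n. (1 - prob_le \<nu> \<mu> n m) / \<mu> k)"
    by (simp add: sum_distrib_left)
  also have "\<dots> \<le> (\<Sum>k=1..n. (1 - prob_le \<nu> \<mu> k m) / \<mu> k)"
    by (intro sum_mono divide_right_mono) (auto simp: prob_le_mono less_imp_le[OF \<mu>])
  also have "\<dots> = (\<Sum>i\<le>m. fps_nth (neg_binomial_fps \<nu>) (m - i) * prob_le \<nu> \<mu> n i)"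
    by (rule prob_le_convolution [symmetric])
  also have "\<dots> \<le> (\<Sum>i\<le>m. fps_nth (neg_binomial_fps \<nu>) (m - i))"
    by (intro sum_mono mult_left_le prob_le_le_1 weight_nonneg)
  finally show ?thesis by (simp add: sum_weights)
qed

text \<open>
  Replace $S_n$ at earlier times by its smaller present value on the left of the convolution
  identity, and each $1 - S_k$ by $1$ on its right.
\<close>

lemma prob_le_upper: "prob_le \<nu> \<mu> n m * fps_nth (neg_binomial_fps (1 + \<nu>)) m \<le> (\<Sum>k=1..n. 1 / \<mu> k)"
proof -
  have "prob_le \<nu> \<mu> n m * fps_nth (neg_binomial_fps (1 + \<nu>)) m
      = (\<Sum>i\<le>m. fps_nth (neg_binomial_fps \<nu>) (m - i) * prob_le \<nu> \<mu> n m)"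
    unfolding sum_weights [symmetric] by (simp add: sum_distrib_left mult.commute)
  also have "\<dots> \<le> (\<Sum>i\<le>m. fps_nth (neg_binomial_fps \<nu>) (m - i) * prob_le \<nu> \<mu> n i)"
    by (intro sum_mono mult_left_mono prob_le_antimono weight_nonneg) auto
  also have "\<dots> = (\<Sum>k=1..n. (1 - prob_le \<nu> \<mu> k m) / \<mu> k)"
    by (rule prob_le_convolution)
  also have "\<dots> \<le> (\<Sum>k=1..n. 1 / \<mu> k)"
    by (intro sum_mono divide_right_mono) (auto simp: prob_le_nonneg less_imp_le[OF \<mu>])
  finally show ?thesis .
qed

end

section \<open>Partial fractions\<close>

lemma fps_const_sum: "fps_const (\<Sum>x\<in>A. f x) = (\<Sum>x\<in>A. fps_const (f x))"
  by (rule fps_ext) (simp add: fps_sum_nth)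

lemma fps_const_prod:
  fixes f :: "'b \<Rightarrow> 'a::comm_ring_1"
  shows "fps_const (\<Prod>x\<in>A. f x) = (\<Prod>x\<in>A. fps_const (f x))"
  by (induction A rule: infinite_finite_induct) (auto simp flip: fps_const_mult)

lemma fps_nth_0_prod:
  fixes f :: "'b \<Rightarrow> 'a::comm_ring_1 fps"
  shows "fps_nth (\<Prod>x\<in>A. f x) 0 = (\<Prod>x\<in>A. fps_nth (f x) 0)"
  by (induction A rule: infinite_finite_induct) auto

text \<open>
  The series $B$ is kept arbitrary since the induction step needs the statement both for the given
  $B$ and for the constant $-a_p$, where $p$ is the new index.
\<close>

lemma prod_inverse_partial_fractions:
  fixes B :: "real fps" and a :: "nat \<Rightarrow> real"
  assumes "finite A" "A \<noteq> {}" "inj_on a A" "\<And>m. m \<in> A \<Longrightarrow> fps_nth B 0 + a m \<noteq> 0"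
  shows "(\<Prod>m\<in>A. inverse (B + fps_const (a m))) =
    (\<Sum>m\<in>A. fps_const (1 / (\<Prod>l\<in>A - {m}. a l - a m)) * inverse (B + fps_const (a m)))"
  using assms
proof (induction A arbitrary: B rule: finite_ne_induct)
  case (singleton x)
  then show ?case by simp
next
  case (insert p A)
  define V where "V m = inverse (B + fps_const (a m))" for m
  define c where "c m = 1 / (\<Prod>l\<in>A - {m}. a l - a m)" for m
  have ne: "a m \<noteq> a p" if "m \<in> A" for m
    using insert.prems(1) insert.hyps(3) that by (auto simp: inj_on_def)
  have inj: "inj_on a A"
    using insert.prems(1) by (auto simp: inj_on_def)
  have V: "(B + fps_const (a m)) * V m = 1" if "m \<in> insert p A" for m
    unfolding V_def using insert.prems(2)[OF that] by (intro inverse_mult_eq_1') simp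
  have split: "V p * V m = fps_const (1 / (a p - a m)) * (V m - V p)" if "m \<in> A" for m
  proof -
    have "V m - V p = V m * ((B + fps_const (a p)) * V p) - V p * ((B + fps_const (a m)) * V m)"
      using V[of m] V[of p] that by simp
    also have "\<dots> = fps_const (a p - a m) * (V p * V m)"
      by (simp add: algebra_simps flip: fps_const_sub)
    finally have "fps_const (1 / (a p - a m)) * (V m - V p) =
        (fps_const (1 / (a p - a m)) * fps_const (a p - a m)) * (V p * V m)"
      by (simp add: mult.assoc)
    also have "\<dots> = V p * V m"
      using ne[OF that] by simp
    finally show ?thesis ..
  qed
  \<comment> \<open>The induction hypothesis for a constant series gives the coefficient at the new node.\<close>
  have "(\<Prod>m\<in>A. inverse (fps_const (- a p) + fps_const (a m))) =
      (\<Sum>m\<in>A. fps_const (c m) * inverse (fps_const (- a p) + fps_const (a m)))"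
    unfolding c_def using inj ne by (intro insert.IH) auto
  then have "fps_nth (\<Prod>m\<in>A. inverse (fps_const (- a p) + fps_const (a m))) 0 =
      fps_nth (\<Sum>m\<in>A. fps_const (c m) * inverse (fps_const (- a p) + fps_const (a m))) 0"
    by (rule arg_cong)
  then have "(\<Prod>m\<in>A. inverse (a m - a p)) = (\<Sum>m\<in>A. c m * inverse (a m - a p))"
    by (simp add: fps_nth_0_prod fps_sum_nth)
  then have scalar: "(\<Sum>m\<in>A. c m / (a m - a p)) = 1 / (\<Prod>m\<in>A. a m - a p)"
    by (simp add: inverse_eq_divide prod_dividef)
  have "(\<Prod>m\<in>insert p A. V m) = V p * (\<Prod>m\<in>A. V m)"
    using insert.hyps by simp
  also have "(\<Prod>m\<in>A. V m) = (\<Sum>m\<in>A. fps_const (c m) * V m)"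
    unfolding V_def c_def using inj insert.prems by (intro insert.IH) auto
  also have "V p * \<dots> = (\<Sum>m\<in>A. fps_const (c m / (a p - a m)) * (V m - V p))"
    unfolding sum_distrib_left
  proof (intro sum.cong refl)
    fix m assume m: "m \<in> A"
    have "V p * (fps_const (c m) * V m) = fps_const (c m) * (V p * V m)"
      by (simp only: mult_ac)
    also have "\<dots> = (fps_const (c m) * fps_const (1 / (a p - a m))) * (V m - V p)"
      by (simp only: split[OF m] mult.assoc)
    finally show "V p * (fps_const (c m) * V m) = fps_const (c m / (a p - a m)) * (V m - V p)"
      by simp
  qed
  also have "\<dots> = fps_const (\<Sum>m\<in>A. c m * inverse (a m - a p)) * V p +
      (\<Sum>m\<in>A. fps_const (c m / (a p - a m)) * V m)"
  proof -
    have "fps_const (c m / (a p - a m)) * (V m - V p) =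
        fps_const (c m * inverse (a m - a p)) * V p + fps_const (c m / (a p - a m)) * V m"
      if "m \<in> A" for m
    proof -
      have "c m * inverse (a m - a p) = - (c m / (a p - a m))"
        using ne[OF that] by (simp add: field_simps)
      then show ?thesis
        by (simp add: algebra_simps flip: fps_const_neg)
    qed
    then show ?thesis
      by (simp add: sum.distrib sum_distrib_right add: fps_const_sum)
  qed
  also have "\<dots> = (\<Sum>m\<in>insert p A. fps_const (1 / (\<Prod>l\<in>insert p A - {m}. a l - a m)) * V m)"
  proof -
    have "insert p A - {p} = A" using insert.hyps by auto
    moreover have "c m / (a p - a m) = 1 / (\<Prod>l\<in>insert p A - {m}. a l - a m)" if "m \<in> A" for m
    proof -
      have "insert p A - {m} = insert p (A - {m})" using that insert.hyps by auto
      then show ?thesis using insert.hyps by (simp add: c_def)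
    qed
    ultimately show ?thesis
      using insert.hyps
      by (simp add: scalar inverse_eq_divide)
  qed
  finally show ?case unfolding V_def .
qed

section \<open>Growth of the coefficients\<close>

lemma neg_binomial_fps_sums:
  assumes "0 \<le> r" "r < 1"
  shows "(\<lambda>n. fps_nth (neg_binomial_fps a) n * r ^ n) sums (1 - r) powr (- a)"
proof -
  have "(\<lambda>n. (- a gchoose n) * (- r) ^ n) sums (1 + - r) powr (- a)"
    using assms by (intro gen_binomial_real) auto
  moreover have "(- a gchoose n) * (- r) ^ n = fps_nth (neg_binomial_fps a) n * r ^ n" for n
  proof -
    have "(- a gchoose n) * (- r) ^ n =
        ((- 1) ^ n * (- 1) ^ n) * (fps_nth (neg_binomial_fps a) n * r ^ n)"
      by (simp add: gbinomial_pochhammer neg_binomial_fps_nth power_minus[of r] mult_ac)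
    also have "(- 1) ^ n * (- 1) ^ n = (1 :: real)"
      by (simp flip: power_mult_distrib)
    finally show ?thesis by simp
  qed
  ultimately show ?thesis by simp
qed

text \<open>
  A saddle point bound. Bounding the partial sums of $R_a$, instead of a single coefficient of
  $R_{a+1}$, saves a factor $1/(1-r)$; this makes the bound uniform in $N$ at $r = 1 - K/N$.
\<close>

lemma neg_binomial_fps_le:
  assumes "a \<ge> 0" "0 < r" "r < 1"
  shows "fps_nth (neg_binomial_fps (a + 1)) n \<le> (1 - r) powr (- a) / r ^ n"
proof -
  have "fps_nth (neg_binomial_fps (a + 1)) n * r ^ n = (\<Sum>i\<le>n. fps_nth (neg_binomial_fps a) i * r ^ n)"
    by (simp add: neg_binomial_fps_add mult.commute[of _ "neg_binomial_fps 1"]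
        neg_binomial_fps_1_mult_nth sum_distrib_right)
  also have "\<dots> \<le> (\<Sum>i\<le>n. fps_nth (neg_binomial_fps a) i * r ^ i)"
    using assms by (intro sum_mono mult_left_mono power_decreasing neg_binomial_fps_nonneg) auto
  also have "\<dots> \<le> (1 - r) powr (- a)"
    using neg_binomial_fps_sums[of r a] assms
    by (metis (no_types, lifting) atMost_iff finite_atMost mult_nonneg_nonneg
        neg_binomial_fps_nonneg order_less_imp_le sum_le_suminf sums_unique sums_summable zero_le_power)
  finally show ?thesis using assms by (simp add: field_simps)
qed

lemma neg_binomial_fps_asymp:
  assumes "a \<ge> 0"
  shows "(\<lambda>N. fps_nth (neg_binomial_fps (a + 1)) N / real N powr a) \<longlonglongrightarrow> 1 / Gamma (a + 1)"
proof -
  have "(\<lambda>N. (a + 1) / (a + 1 + real N)) \<longlonglongrightarrow> 0"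
    by (rule real_tendsto_divide_at_top[OF tendsto_const
          filterlim_tendsto_add_at_top[OF tendsto_const filterlim_real_sequentially]])
  then have "(\<lambda>N. 1 - (a + 1) / (a + 1 + real N)) \<longlonglongrightarrow> 1"
    by (auto intro: tendsto_eq_intros)
  moreover have "1 - (a + 1) / (a + 1 + real N) = real N / (a + 1 + real N)" for N
    using assms by (simp add: field_simps)
  ultimately have "(\<lambda>N. rGamma_series (a + 1) N * (real N / (a + 1 + real N)))
      \<longlonglongrightarrow> rGamma (a + 1) * 1"
    by (intro tendsto_mult rGamma_series_LIMSEQ) simp
  moreover have "\<forall>\<^sub>F N in sequentially. rGamma_series (a + 1) N * (real N / (a + 1 + real N)) =
      fps_nth (neg_binomial_fps (a + 1)) N / real N powr a"
    using eventually_gt_at_top[of 0]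
  proof eventually_elim
    case (elim N)
    have "exp ((a + 1) * ln (real N)) = real N powr a * real N"
      using elim by (simp add: powr_def exp_add distrib_right)
    moreover have "a + 1 + real N \<noteq> 0" using assms by linarith
    ultimately show ?case
      using elim by (simp add: rGamma_series_def neg_binomial_fps_nth pochhammer_Suc)
  qed
  ultimately show ?thesis
    by (simp add: tendsto_cong rGamma_inverse_Gamma inverse_eq_divide)
qed

section \<open>The Mittag-Leffler function as a limit of resolvents\<close>

text \<open>
  Formally $R_{1-\<nu>} V = R_1 / (1 + y R_\<nu>)$, expanded as a geometric series in $-y R_\<nu>$.
  That series does not converge as a formal series, because $R_\<nu>$ has constant coefficient $1$,
  so the coefficients are summed numerically and multiplied by $R_{-\<nu>} + y$.
\<close>

lemma resolvent_series:
  assumes \<nu>: "0 \<le> \<nu>" and y: "y \<ge> 0"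
    and summable: "summable (\<lambda>k. y ^ k * fps_nth (neg_binomial_fps (\<nu> * real k + 1)) N)"
  shows "fps_nth (neg_binomial_fps (1 - \<nu>) * resolvent \<nu> y) N =
    (\<Sum>k. (- y) ^ k * fps_nth (neg_binomial_fps (\<nu> * real k + 1)) N)"
proof -
  define r where "r k = neg_binomial_fps (\<nu> * real k + 1)" for k
  define S where "S M = (\<Sum>k. (- y) ^ k * fps_nth (r k) M)" for M
  \<comment> \<open>Summability is available only up to index \<open>N\<close>; truncating leaves these coefficients intact.\<close>
  define F where "F = Abs_fps (\<lambda>M. if M \<le> N then S M else 0)"
  have summ: "summable (\<lambda>k. (- y) ^ k * fps_nth (r k) M)" if "M \<le> N" for M
  proof (rule summable_comparison_test'[OF summable])
    fix k
    have "fps_nth (r k) M \<le> fps_nth (r k) N" "fps_nth (r k) M \<ge> 0"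
      using \<nu> that unfolding r_def by (auto intro!: neg_binomial_fps_mono neg_binomial_fps_nonneg)
    then show "norm ((- y) ^ k * fps_nth (r k) M) \<le> y ^ k * fps_nth (neg_binomial_fps (\<nu> * real k + 1)) N"
      using y by (simp add: abs_mult power_abs r_def mult_left_mono)
  qed
  have key: "fps_nth ((neg_binomial_fps (- \<nu>) + fps_const y) * F) M = fps_nth (neg_binomial_fps (1 - \<nu>)) M"
    if M: "M \<le> N" for M
  proof -
    have rec0: "neg_binomial_fps (- \<nu>) * r 0 = neg_binomial_fps (1 - \<nu>)"
      by (simp add: r_def flip: neg_binomial_fps_add)
    have recS: "neg_binomial_fps (- \<nu>) * r (Suc k) = r k" for k
      by (simp add: r_def algebra_simps flip: neg_binomial_fps_add)
    have "fps_nth (neg_binomial_fps (- \<nu>) * F) M =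
        (\<Sum>i\<le>M. fps_nth (neg_binomial_fps (- \<nu>)) i * S (M - i))"
      using M by (auto simp: fps_mult_nth F_def atLeast0AtMost intro!: sum.cong)
    also have "\<dots> = (\<Sum>i\<le>M. \<Sum>k. fps_nth (neg_binomial_fps (- \<nu>)) i * ((- y) ^ k * fps_nth (r k) (M - i)))"
      unfolding S_def using M by (intro sum.cong refl suminf_mult [symmetric] summ) auto
    also have "\<dots> = (\<Sum>k. \<Sum>i\<le>M. fps_nth (neg_binomial_fps (- \<nu>)) i * ((- y) ^ k * fps_nth (r k) (M - i)))"
      using M by (intro suminf_sum [symmetric] summable_mult summ) auto
    also have "\<dots> = (\<Sum>k. (- y) ^ k * fps_nth (neg_binomial_fps (- \<nu>) * r k) M)"
      unfolding fps_mult_nth atLeast0AtMost sum_distrib_left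
      by (intro suminf_cong sum.cong refl mult.left_commute)
    also have "\<dots> = fps_nth (neg_binomial_fps (1 - \<nu>)) M - y * S M"
    proof (rule sums_unique [symmetric])
      have "(\<lambda>k. (- y) * ((- y) ^ k * fps_nth (r k) M)) sums ((- y) * S M)"
        unfolding S_def using M by (intro sums_mult summable_sums summ)
      then have "(\<lambda>k. (- y) ^ Suc k * fps_nth (neg_binomial_fps (- \<nu>) * r (Suc k)) M) sums (- y * S M)"
        by (simp add: recS mult.assoc)
      from sums_Suc[OF this]
      show "(\<lambda>k. (- y) ^ k * fps_nth (neg_binomial_fps (- \<nu>) * r k) M) sums
          (fps_nth (neg_binomial_fps (1 - \<nu>)) M - y * S M)"
        by (simp add: rec0)
    qed
    finally show ?thesis
      using M by (simp add: distrib_right F_def)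
  qed
  have "F = (resolvent \<nu> y * (neg_binomial_fps (- \<nu>) + fps_const y)) * F"
    by (simp add: resolvent_mult[OF y])
  then have "fps_nth F N = fps_nth (resolvent \<nu> y * ((neg_binomial_fps (- \<nu>) + fps_const y) * F)) N"
    by (simp only: mult.assoc)
  also have "\<dots> = fps_nth (resolvent \<nu> y * neg_binomial_fps (1 - \<nu>)) N"
    by (auto simp: fps_mult_nth[of "resolvent \<nu> y"] key intro!: sum.cong)
  finally show ?thesis
    by (simp add: F_def S_def r_def mult.commute)
qed

text \<open>
  The coefficients of the expansion converge termwise by Euler's limit formula for the Gamma
  function, and a geometric majorant uniform in $N$ allows the limit to be taken under the sum.
\<close>

lemma mittag_leffler_limit:
  assumes \<nu>: "0 < \<nu>" and Y: "Y \<ge> 0"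
  shows "(\<lambda>N. fps_nth (neg_binomial_fps (1 - \<nu>) * resolvent \<nu> (Y / real N powr \<nu>)) N)
    \<longlonglongrightarrow> mittag_leffler \<nu> 1 (- Y)"
proof -
  \<comment> \<open>Evaluating at $1 - K/N$ bounds the \<open>k\<close>th term by a multiple of $(K^{-\<nu>} Y)^k$,
    and \<open>K\<close> is chosen to make this ratio at most $1/2$.\<close>
  define K where "K = (2 * Y + 1) powr (1 / \<nu>)"
  have K: "K > 0" and KY: "K powr (- \<nu>) * Y \<le> 1 / 2"
  proof -
    show "K > 0" using Y by (simp add: K_def)
    have "K powr \<nu> = 2 * Y + 1"
      using \<nu> Y by (simp add: K_def powr_powr)
    then show "K powr (- \<nu>) * Y \<le> 1 / 2"
      using Y by (simp add: powr_minus field_simps)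
  qed
  have "(\<lambda>N. 1 / (1 - K / real N) ^ N) \<longlonglongrightarrow> 1 / exp (- K)"
    using tendsto_exp_limit_sequentially[of "- K"] by (intro tendsto_divide) auto
  then have "Bseq (\<lambda>N. 1 / (1 - K / real N) ^ N)"
    by (intro convergent_imp_Bseq convergentI)
  then obtain C where C: "\<And>N. norm (1 / (1 - K / real N) ^ N) \<le> C"
    by (rule BseqE) blast
  define f where
    "f k N = (- (Y / real N powr \<nu>)) ^ k * fps_nth (neg_binomial_fps (\<nu> * real k + 1)) N" for k N
  have bound: "norm (f k N) \<le> C * (1 / 2) ^ k" if N: "real N > K" for k N
  proof -
    define r where "r = 1 - K / real N"
    have r: "0 < r" "r < 1" using N K by (auto simp: r_def)
    have N0: "real N > 0" using N K by linarith
    have nn: "fps_nth (neg_binomial_fps (\<nu> * real k + 1)) N \<ge> 0"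
      using \<nu> by (intro neg_binomial_fps_nonneg) auto
    have "norm (f k N) = (Y / real N powr \<nu>) ^ k * fps_nth (neg_binomial_fps (\<nu> * real k + 1)) N"
      using Y nn by (simp add: f_def abs_mult power_abs)
    also have "\<dots> \<le> (Y / real N powr \<nu>) ^ k * ((1 - r) powr (- (\<nu> * real k)) / r ^ N)"
      using Y \<nu> r by (intro mult_left_mono neg_binomial_fps_le) auto
    also have "(1 - r) powr (- (\<nu> * real k)) = (K powr (- \<nu>) * real N powr \<nu>) ^ k"
    proof -
      have "(1 - r) powr (- (\<nu> * real k)) = ((K / real N) powr (- \<nu>)) powr real k"
        by (simp add: r_def powr_powr)
      also have "\<dots> = ((K / real N) powr (- \<nu>)) ^ k"
        using K N0 by (simp add: powr_realpow)
      also have "(K / real N) powr (- \<nu>) = K powr (- \<nu>) * real N powr \<nu>"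
        using K N0 by (simp add: powr_divide powr_minus field_simps)
      finally show ?thesis .
    qed
    also have "(Y / real N powr \<nu>) ^ k * ((K powr (- \<nu>) * real N powr \<nu>) ^ k / r ^ N)
        = (K powr (- \<nu>) * Y) ^ k * (1 / r ^ N)"
      using N0 by (simp add: power_divide power_mult_distrib)
    also have "\<dots> \<le> (1 / 2) ^ k * C"
    proof (intro mult_mono power_mono KY)
      show "1 / r ^ N \<le> C" using C[of N] r by (simp add: r_def)
    qed (use Y r in auto)
    finally show ?thesis by (simp add: mult.commute)
  qed
  have evN: "\<forall>\<^sub>F N in sequentially. real N > K"
    using filterlim_real_sequentially by (simp add: filterlim_at_top_dense)
  have lim: "(\<lambda>N. f k N) \<longlonglongrightarrow> (- Y) ^ k / Gamma (\<nu> * real k + 1)" for k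
  proof -
    have "(\<lambda>N. (- Y) ^ k * (fps_nth (neg_binomial_fps (\<nu> * real k + 1)) N / real N powr (\<nu> * real k)))
        \<longlonglongrightarrow> (- Y) ^ k * (1 / Gamma (\<nu> * real k + 1))"
      using \<nu> by (intro tendsto_mult tendsto_const neg_binomial_fps_asymp) auto
    moreover have "\<forall>\<^sub>F N in sequentially.
        (- Y) ^ k * (fps_nth (neg_binomial_fps (\<nu> * real k + 1)) N / real N powr (\<nu> * real k)) = f k N"
      using eventually_gt_at_top[of 0]
    proof eventually_elim
      case (elim N)
      have "(real N powr \<nu>) ^ k = real N powr (\<nu> * real k)"
        using elim by (simp add: powr_powr flip: powr_realpow)
      then have "(- (Y / real N powr \<nu>)) ^ k = (- Y) ^ k / real N powr (\<nu> * real k)"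
        by (metis minus_divide_left power_divide)
      then show ?case by (simp add: f_def)
    qed
    ultimately show ?thesis by (simp add: tendsto_cong)
  qed
  have "(\<lambda>N. \<Sum>k. f k N) \<longlonglongrightarrow> (\<Sum>k. (- Y) ^ k / Gamma (\<nu> * real k + 1))"
  proof -
    have "\<forall>\<^sub>F (k, N) in at_top \<times>\<^sub>F sequentially. norm (f k N) \<le> C * (1 / 2) ^ k"
      unfolding case_prod_unfold
      using eventually_prodI[where P = "\<lambda>_. True", OF eventually_True evN] by eventually_elim (use bound in auto)
    then show ?thesis
      by (rule tannerys_theorem[THEN conjunct2, THEN conjunct2, OF lim]) (auto intro: summable_mult summable_geometric)
  qed
  moreover have "\<forall>\<^sub>F N in sequentially. (\<Sum>k. f k N) =
      fps_nth (neg_binomial_fps (1 - \<nu>) * resolvent \<nu> (Y / real N powr \<nu>)) N"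
    using evN
  proof eventually_elim
    case (elim N)
    have "summable (\<lambda>k. (Y / real N powr \<nu>) ^ k * fps_nth (neg_binomial_fps (\<nu> * real k + 1)) N)"
    proof (rule summable_comparison_test')
      show "summable (\<lambda>k. C * (1 / 2) ^ k)" by (auto intro: summable_mult summable_geometric)
      show "norm ((Y / real N powr \<nu>) ^ k * fps_nth (neg_binomial_fps (\<nu> * real k + 1)) N)
          \<le> C * (1 / 2) ^ k" for k
        using bound[OF elim, of k] by (simp add: f_def abs_mult power_abs)
    qed
    then show ?case
      unfolding f_def using \<nu> Y by (subst resolvent_series) auto
  qed
  ultimately show ?thesis
    unfolding mittag_leffler_def by (simp add: tendsto_cong)
qed

section \<open>Passage to the limit\<close>

text \<open>
  The powers of the mesh factor \<open>c\<close> cancel: the product of the first $k-1$ rates and each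
  product of $k-1$ differences of rates have the same degree.
\<close>

lemma state_fps_partial_fractions:
  fixes rate :: "nat \<Rightarrow> real"
  assumes pos: "\<And>k. k \<ge> 1 \<Longrightarrow> rate k > 0" and distinct: "inj_on rate {1..}"
    and c: "c > 0" and k: "k \<ge> 1"
  shows "fps_nth (state_fps \<nu> (\<lambda>j. rate j * c) k) N =
    (\<Prod>j=1..k-1. rate j) *
      (\<Sum>m=1..k. fps_nth (neg_binomial_fps (1 - \<nu>) * resolvent \<nu> (rate m * c)) N /
        (\<Prod>l\<in>{1..k} - {m}. rate l - rate m))"
proof -
  define V where "V m = resolvent \<nu> (rate m * c)" for m
  define d where "d m = (\<Prod>l\<in>{1..k} - {m}. rate l - rate m)" for m
  have split: "{1..k} = insert k {1..k-1}" using k by auto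
  have pf: "(\<Prod>m=1..k. V m) = (\<Sum>m=1..k. fps_const (1 / (c ^ (k - 1) * d m)) * V m)"
  proof -
    have "(\<Prod>m\<in>{1..k}. V m) =
        (\<Sum>m\<in>{1..k}. fps_const (1 / (\<Prod>l\<in>{1..k} - {m}. rate l * c - rate m * c)) * V m)"
      unfolding V_def resolvent_def
    proof (rule prod_inverse_partial_fractions)
      show "inj_on (\<lambda>j. rate j * c) {1..k}"
        using c distinct by (auto simp: inj_on_def)
      show "fps_nth (neg_binomial_fps (- \<nu>)) 0 + rate m * c \<noteq> 0" if "m \<in> {1..k}" for m
      proof -
        have "rate m * c > 0" using that pos c by simp
        then show ?thesis by (simp add: neg_binomial_fps_nth)
      qed
    qed (use k in auto)
    also have "\<dots> = (\<Sum>m\<in>{1..k}. fps_const (1 / (c ^ (k - 1) * d m)) * V m)"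
    proof (intro sum.cong refl)
      fix m assume "m \<in> {1..k}"
      then have card: "card ({1..k} - {m}) = k - 1" by simp
      have "(\<Prod>l\<in>{1..k} - {m}. rate l * c - rate m * c) = (\<Prod>l\<in>{1..k} - {m}. c * (rate l - rate m))"
        by (simp add: algebra_simps)
      also have "\<dots> = c ^ (k - 1) * d m"
        by (simp only: prod.distrib prod_constant card d_def)
      finally show "fps_const (1 / (\<Prod>l\<in>{1..k} - {m}. rate l * c - rate m * c)) * V m =
          fps_const (1 / (c ^ (k - 1) * d m)) * V m" by simp
    qed
    finally show ?thesis .
  qed
  have "state_fps \<nu> (\<lambda>j. rate j * c) k =
      neg_binomial_fps (1 - \<nu>) * (fps_const (c ^ (k - 1) * (\<Prod>j=1..k-1. rate j)) * (\<Prod>m=1..k. V m))"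
  proof -
    have "(\<Prod>j=1..k-1. fps_const (rate j * c)) = fps_const (c ^ (k - 1) * (\<Prod>j=1..k-1. rate j))"
      by (simp add: prod.distrib mult.commute flip: fps_const_prod)
    moreover have "(\<Prod>m=1..k. V m) = V k * (\<Prod>m=1..k-1. V m)"
      by (subst split, subst prod.insert) (use k in auto)
    ultimately show ?thesis
      by (simp add: state_fps_def birth_time_fps_def V_def prod.distrib mult_ac)
  qed
  also have "\<dots> = (\<Sum>m=1..k. fps_const ((\<Prod>j=1..k-1. rate j) / d m) * (neg_binomial_fps (1 - \<nu>) * V m))"
    unfolding pf sum_distrib_left
  proof (intro sum.cong refl)
    fix m assume "m \<in> {1..k}"
    let ?p = "\<Prod>j=1..k-1. rate j"
    have "neg_binomial_fps (1 - \<nu>) * (fps_const (c ^ (k - 1) * ?p) * (fps_const (1 / (c ^ (k - 1) * d m)) * V m))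
        = (fps_const (c ^ (k - 1) * ?p) * fps_const (1 / (c ^ (k - 1) * d m))) * (neg_binomial_fps (1 - \<nu>) * V m)"
      by (simp only: mult_ac)
    also have "fps_const (c ^ (k - 1) * ?p) * fps_const (1 / (c ^ (k - 1) * d m)) = fps_const (?p / d m)"
      using c by simp
    finally show "neg_binomial_fps (1 - \<nu>) * (fps_const (c ^ (k - 1) * ?p) *
        (fps_const (1 / (c ^ (k - 1) * d m)) * V m)) =
        fps_const (?p / d m) * (neg_binomial_fps (1 - \<nu>) * V m)" .
  qed
  finally show ?thesis
    by (simp add: fps_sum_nth sum_distrib_left d_def V_def)
qed

lemma fbp_prob_limit:
  fixes rate :: "nat \<Rightarrow> real"
  assumes pos: "\<And>k. k \<ge> 1 \<Longrightarrow> rate k > 0" and distinct: "inj_on rate {1..}"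
    and \<nu>: "0 < \<nu>" and t: "t > 0" and k: "k \<ge> 1"
  shows "(\<lambda>N. fps_nth (state_fps \<nu> (\<lambda>j. rate j * (t powr \<nu> / real N powr \<nu>)) k) N)
    \<longlonglongrightarrow> fbp_prob rate \<nu> k t"
proof -
  have "(\<lambda>N. (\<Prod>j=1..k-1. rate j) *
      (\<Sum>m=1..k. fps_nth (neg_binomial_fps (1 - \<nu>) * resolvent \<nu> (rate m * (t powr \<nu> / real N powr \<nu>))) N /
        (\<Prod>l\<in>{1..k} - {m}. rate l - rate m)))
    \<longlonglongrightarrow> (\<Prod>j=1..k-1. rate j) * (\<Sum>m=1..k. mittag_leffler \<nu> 1 (- (rate m * t powr \<nu>)) /
        (\<Prod>l\<in>{1..k} - {m}. rate l - rate m))"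
  proof (intro tendsto_mult tendsto_const tendsto_sum tendsto_divide)
    fix m assume m: "m \<in> {1..k}"
    show "(\<lambda>N. fps_nth (neg_binomial_fps (1 - \<nu>) * resolvent \<nu> (rate m * (t powr \<nu> / real N powr \<nu>))) N)
      \<longlonglongrightarrow> mittag_leffler \<nu> 1 (- (rate m * t powr \<nu>))"
      using mittag_leffler_limit[of \<nu> "rate m * t powr \<nu>"] \<nu> m pos[of m] by simp
    show "(\<Prod>l\<in>{1..k} - {m}. rate l - rate m) \<noteq> 0"
      using m distinct by (auto simp: inj_on_def)
  qed
  also have "(\<Prod>j=1..k-1. rate j) * (\<Sum>m=1..k. mittag_leffler \<nu> 1 (- (rate m * t powr \<nu>)) /
        (\<Prod>l\<in>{1..k} - {m}. rate l - rate m)) = fbp_prob rate \<nu> k t"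
    by (auto simp: fbp_prob_def)
  finally show ?thesis
  proof (rule Lim_transform_eventually)
    show "\<forall>\<^sub>F N in sequentially. (\<Prod>j=1..k-1. rate j) *
      (\<Sum>m=1..k. fps_nth (neg_binomial_fps (1 - \<nu>) * resolvent \<nu> (rate m * (t powr \<nu> / real N powr \<nu>))) N /
        (\<Prod>l\<in>{1..k} - {m}. rate l - rate m)) =
      fps_nth (state_fps \<nu> (\<lambda>j. rate j * (t powr \<nu> / real N powr \<nu>)) k) N"
      using eventually_gt_at_top[of 0]
    proof eventually_elim
      case (elim N)
      then have "t powr \<nu> / real N powr \<nu> > 0" using t by simp
      from state_fps_partial_fractions[OF pos distinct this k] show ?case by simp
    qed
  qed
qed

lemma fbp_prob_nonneg:
  fixes rate :: "nat \<Rightarrow> real"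
  assumes pos: "\<And>k. k \<ge> 1 \<Longrightarrow> rate k > 0" and distinct: "inj_on rate {1..}"
    and \<nu>: "0 < \<nu>" "\<nu> \<le> 1" and t: "t > 0" and k: "k \<ge> 1"
  shows "fbp_prob rate \<nu> k t \<ge> 0"
proof (rule tendsto_lowerbound)
  show "(\<lambda>N. fps_nth (state_fps \<nu> (\<lambda>j. rate j * (t powr \<nu> / real N powr \<nu>)) k) N) \<longlonglongrightarrow> fbp_prob rate \<nu> k t"
    by (rule fbp_prob_limit[OF pos distinct \<nu>(1) t k])
next
  show "\<forall>\<^sub>F N in sequentially. 0 \<le> fps_nth (state_fps \<nu> (\<lambda>j. rate j * (t powr \<nu> / real N powr \<nu>)) k) N"
    using eventually_gt_at_top[of 0]
  proof eventually_elim
    case (elim N)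
    have "rate j * (t powr \<nu> / real N powr \<nu>) > 0" if "j \<ge> 1" for j
      using pos[OF that] t elim by simp
    from state_fps_nonneg[OF less_imp_le[OF \<nu>(1)] \<nu>(2) this k] show ?case .
  qed
qed simp

lemma fbp_prob_sum_bounds:
  fixes rate :: "nat \<Rightarrow> real"
  assumes pos: "\<And>k. k \<ge> 1 \<Longrightarrow> rate k > 0" and distinct: "inj_on rate {1..}"
    and \<nu>: "0 < \<nu>" "\<nu> \<le> 1" and t: "t > 0"
  defines "S n \<equiv> \<Sum>k=1..n. fbp_prob rate \<nu> k t" and "H n \<equiv> \<Sum>k=1..n. 1 / rate k"
    and "\<tau> \<equiv> t powr \<nu> / Gamma (\<nu> + 1)"
  shows "S n \<le> 1" and "(1 - S n) * H n \<le> \<tau>" and "S n * \<tau> \<le> H n"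
proof -
  define c where "c N = t powr \<nu> / real N powr \<nu>" for N
  define s where "s N = prob_le \<nu> (\<lambda>j. rate j * c N) n N" for N
  define w where "w N = fps_nth (neg_binomial_fps (1 + \<nu>)) N" for N
  have s_lim: "s \<longlonglongrightarrow> S n"
    unfolding s_def S_def prob_le_def c_def
    by (intro tendsto_sum fbp_prob_limit pos distinct \<nu> t) auto
  have "(\<lambda>N. t powr \<nu> * (w N / real N powr \<nu>)) \<longlonglongrightarrow> t powr \<nu> * (1 / Gamma (\<nu> + 1))"
    unfolding w_def using \<nu> neg_binomial_fps_asymp[of \<nu>]
    by (intro tendsto_mult tendsto_const) (auto simp: add.commute)
  then have w_lim: "(\<lambda>N. c N * w N) \<longlonglongrightarrow> \<tau>"
    by (simp add: c_def \<tau>_def)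
  have H: "(\<Sum>k=1..n. 1 / (rate k * c N)) = H n / c N" for N
    by (simp add: H_def sum_divide_distrib)
  have ev: "\<forall>\<^sub>F N in sequentially. s N \<le> 1 \<and> (1 - s N) * H n \<le> c N * w N \<and> s N * (c N * w N) \<le> H n"
    using eventually_gt_at_top[of 0]
  proof eventually_elim
    case (elim N)
    then have c: "c N > 0" using t by (simp add: c_def)
    have \<mu>: "rate k * c N > 0" if "k \<ge> 1" for k using pos[OF that] c by simp
    have \<nu>': "0 \<le> \<nu>" using \<nu> by simp
    note prems = \<nu>' \<nu>(2) \<mu>
    have "s N \<le> 1" unfolding s_def by (rule prob_le_le_1[OF prems])
    moreover have "(1 - s N) * (H n / c N) \<le> w N"
      unfolding s_def w_def H [symmetric] by (rule prob_le_lower[OF prems])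
    moreover have "s N * w N \<le> H n / c N"
      unfolding s_def w_def H [symmetric] by (rule prob_le_upper[OF prems])
    ultimately show ?case using c by (simp add: field_simps)
  qed
  show "S n \<le> 1"
    by (rule tendsto_upperbound[OF s_lim]) (use ev in \<open>auto elim: eventually_mono\<close>)
  show "(1 - S n) * H n \<le> \<tau>"
    by (rule tendsto_le[OF _ w_lim tendsto_mult[OF tendsto_diff[OF tendsto_const s_lim] tendsto_const]])
      (use ev in \<open>auto elim: eventually_mono\<close>)
  show "S n * \<tau> \<le> H n"
    by (rule tendsto_upperbound[OF tendsto_mult[OF s_lim w_lim]])
      (use ev in \<open>auto elim: eventually_mono\<close>)
qed

theorem mainTheorem3:
  fixes rate :: "nat \<Rightarrow> real"
  assumes pos: "\<And>k. k \<ge> 1 \<Longrightarrow> rate k > 0"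
    and distinct: "inj_on rate {1..}"
  shows "(\<forall>\<nu> t. \<forall>k\<ge>1. 0 < \<nu> \<and> \<nu> \<le> 1 \<and> 0 < t \<longrightarrow> fbp_prob rate \<nu> k t \<ge> 0) \<and>
         (\<forall>\<nu>. 0 < \<nu> \<and> \<nu> \<le> 1 \<longrightarrow>
            (non_exploding rate \<nu> \<longleftrightarrow>
             filterlim (\<lambda>n. \<Sum>k=1..n. 1 / rate k) at_top sequentially))"
proof (intro conjI allI impI)
  show "fbp_prob rate \<nu> k t \<ge> 0" if "k \<ge> 1" "0 < \<nu> \<and> \<nu> \<le> 1 \<and> 0 < t" for \<nu> t k
    using that by (intro fbp_prob_nonneg pos distinct) auto
next
  fix \<nu> :: real
  assume "0 < \<nu> \<and> \<nu> \<le> 1"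
  then have \<nu>: "0 < \<nu>" "\<nu> \<le> 1" by auto
  define H where "H n = (\<Sum>k=1..n. 1 / rate k)" for n
  define S where "S t n = (\<Sum>k=1..n. fbp_prob rate \<nu> k t)" for t n
  define \<tau> where "\<tau> t = t powr \<nu> / Gamma (\<nu> + 1)" for t
  have S_le: "S t n \<le> 1" and S_lower: "(1 - S t n) * H n \<le> \<tau> t" and S_upper: "S t n * \<tau> t \<le> H n"
    if "t > 0" for t n
    using fbp_prob_sum_bounds[OF pos distinct \<nu> that] by (simp_all add: S_def H_def \<tau>_def)
  have non_exploding: "non_exploding rate \<nu> \<longleftrightarrow> (\<forall>t>0. S t \<longlonglongrightarrow> 1)"
  proof -
    have "(\<Sum>k<n. fbp_prob rate \<nu> (Suc k) t) = S t n" for n t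
      by (simp add: S_def sum.atLeast1_atMost_eq)
    then show ?thesis
      by (simp add: non_exploding_def sums_def)
  qed
  have "H n \<le> H (Suc n)" for n
    using pos[of "Suc n"] by (simp add: H_def)
  then have "mono H" by (rule incseq_SucI)
  have "non_exploding rate \<nu> \<longleftrightarrow> filterlim H at_top sequentially"
  proof
    assume "filterlim H at_top sequentially"
    show "non_exploding rate \<nu>"
      unfolding non_exploding
    proof (intro allI impI)
      fix t :: real assume t: "t > 0"
      have "(\<lambda>n. \<tau> t / H n) \<longlonglongrightarrow> 0"
        by (rule real_tendsto_divide_at_top[OF tendsto_const \<open>filterlim H at_top sequentially\<close>])
      then have "(\<lambda>n. 1 - \<tau> t / H n) \<longlonglongrightarrow> 1"
        by (auto intro: tendsto_eq_intros)
      moreover have "\<forall>\<^sub>F n in sequentially. H n > 0"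
        using \<open>filterlim H at_top sequentially\<close> by (simp add: filterlim_at_top_dense)
      then have "\<forall>\<^sub>F n in sequentially. 1 - \<tau> t / H n \<le> S t n"
      proof eventually_elim
        case (elim n)
        then have "1 - S t n \<le> \<tau> t / H n"
          using S_lower[OF t, of n] by (simp add: pos_le_divide_eq)
        then show ?case by linarith
      qed
      ultimately show "S t \<longlonglongrightarrow> 1"
        using tendsto_sandwich[of "\<lambda>n. 1 - \<tau> t / H n" "S t" sequentially "\<lambda>_. 1" 1]
        by (simp add: S_le t)
    qed
  next
    assume *: "non_exploding rate \<nu>"
    show "filterlim H at_top sequentially"
    proof (rule ccontr)
      assume "\<not> filterlim H at_top sequentially"
      then obtain M where "\<not> (\<forall>\<^sub>F n in sequentially. M \<le> H n)"
        by (auto simp: filterlim_at_top)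
      have M: "H n < M" for n
      proof (rule ccontr)
        assume "\<not> H n < M"
        then have "M \<le> H m" if "m \<ge> n" for m
          using monoD[OF \<open>mono H\<close> that] by linarith
        with \<open>\<not> (\<forall>\<^sub>F n in sequentially. M \<le> H n)\<close> show False
          by (auto simp: eventually_sequentially)
      qed
      then have "M > 0" using M[of 0] by (simp add: H_def)
      have G: "Gamma (\<nu> + 1) > 0" using \<nu> by (intro Gamma_real_pos) auto
      \<comment> \<open>Chosen to make $t^\<nu>/\<Gamma>(\<nu>+1)$ equal to \<open>2 * M\<close>.\<close>
      define t where "t = (2 * M * Gamma (\<nu> + 1)) powr (1 / \<nu>)"
      have t: "t > 0" using \<open>M > 0\<close> G by (simp add: t_def)
      have "t powr \<nu> = 2 * M * Gamma (\<nu> + 1)"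
        using \<open>M > 0\<close> G \<nu> by (simp add: t_def powr_powr)
      then have "\<tau> t = 2 * M"
        using G by (simp add: \<tau>_def del: Gamma_eq_zero_iff)
      then have "S t n \<le> 1 / 2" for n
      proof -
        have "S t n * (2 * M) \<le> 1 * M"
          using S_upper[OF t, of n] M[of n] \<open>\<tau> t = 2 * M\<close> by simp
        then show ?thesis using \<open>M > 0\<close> by simp
      qed
      moreover have "S t \<longlonglongrightarrow> 1" using * t by (simp add: non_exploding)
      ultimately have "1 \<le> (1 / 2 :: real)" by (intro LIMSEQ_le_const2) auto
      then show False by simp
    qed
  qed
  then show "non_exploding rate \<nu> \<longleftrightarrow>
      filterlim (\<lambda>n. \<Sum>k=1..n. 1 / rate k) at_top sequentially"
    by (simp add: H_def [abs_def])
qed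

end
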